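(* (a) If $p\in[1/\sqrt3,1]$ and $q\in(0,1/2]$, then for all $t\in(0,\pi/2)$ $$(\cos pt)^{1/(2p^2)}<\sqrt{\frac{\sin t}{t}\exp(t\cot t-1)}<(\cos qt)^{1/(2q^2)}.$$ (b) Put $$\beta=\frac{\ln\pi-\ln2+1}{\ln 2}\approx 2.0942,\qquad \gamma=-\frac{\ln\pi-\ln2+1}{2\ln\left(\cos\frac{\pi}{2\sqrt3}\right)}\approx1.4990.$$ Then for all $t\in(0,\pi/2)$ $$\sqrt{\frac{8}{\pi e}}\cos^2\frac t2<\cos^{\beta}\frac t2<\sqrt{\frac{\sin t}{t}\exp(t\cot t-1)}<\cos^2\frac t2,$$ $$\cos^{3/2}\frac{t}{\sqrt3}<\sqrt{\frac{\sin t}{t}\exp(t\cot t-1)}<\cos^{\gamma}\frac{t}{\sqrt3},$$ $$\sqrt{\cos t}<\sqrt{\frac{\sin t}{t}\exp(t\cot t-1)}<\cos^2\frac t2.$$ (c) The exponents $\beta$, $2$, $3/2$, $\gamma$ are best possible. That is, writing $h(t)=\sqrt{\frac{\sin t}{t}\exp(t\cot t-1)}$: if $\cos^{r}\frac t2<h(t)$ for all $t\in(0,\pi/2)$ then $r\ge\beta$; if $h(t)<\cos^{s}\frac t2$ for all $t\in(0,\pi/2)$ then $s\le2$; if $\cos^{r}\frac t{\sqrt3}<h(t)$ for all $t\in(0,\pi/2)$ then $r\ge 3/2$; if $h(t)<\cos^{s}\frac t{\sqrt3}$ for all $t\in(0,\pi/2)$ then $s\le\gamma$. *)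

theory Defs
  imports Complex_Main
begin

definition h_fun :: "real \<Rightarrow> real" where
  "h_fun t = sqrt (sin t / t * exp (t * cot t - 1))"

definition beta_exp :: real where
  "beta_exp = (ln pi - ln 2 + 1) / ln 2"

definition gamma_exp :: real where
  "gamma_exp = - ((ln pi - ln 2 + 1) / (2 * ln (cos (pi / (2 * sqrt 3)))))"

end

theory Submission
  imports Defs "HOL-Real_Asymp.Real_Asymp"
begin

text \<open>
  Write \<open>L = 2 ln h = ln (sin t / t) + t cot t - 1\<close>. Every bound compares \<open>L\<close> with a multiple of
  \<open>ln (cos (c t))\<close>. The quotient \<open>L / ln (cos (t/2))\<close> increases strictly on \<open>(0, \<pi>/2]\<close>, from 4 at 0
  to \<open>2 \<beta>\<close> at \<open>\<pi>/2\<close>, and \<open>L / ln (cos (t/\<surd>3))\<close> decreases strictly, from 3 to \<open>2 \<gamma>\<close>;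
  these end values give both the inequalities and their sharpness. General \<open>p\<close> and \<open>q\<close> reduce to
  \<open>1/\<surd>3\<close> and \<open>1/2\<close> because \<open>- ln (cos x) / x\<^sup>2\<close> is increasing.
  By the monotone form of l'Hopital's rule, monotonicity of the quotients amounts to two inequalities
  between trigonometric polynomials. The second one is delicate: its two sides agree up to
  order \<open>t\<^sup>1\<^sup>1\<close> at 0. Both follow from alternating Taylor bounds for sin and cos at multiples of
  \<open>t\<close>, which leave polynomials in \<open>t\<^sup>2\<close> that are positive on the range \<open>t < 8/5\<close>.
\<close>

section \<open>Taylor bounds for sine and cosine\<close>

text \<open>The index counts terms: for \<open>n > 0\<close> the degree is \<open>2 * n - 1\<close>
  here and \<open>2 * n - 2\<close> for \<open>cos_poly n\<close>. The parity of \<open>n\<close>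
  decides on which side of the function the polynomial lies.\<close>

definition sin_poly :: "nat \<Rightarrow> real \<Rightarrow> real" where
  "sin_poly n x = (\<Sum>k<n. (-1) ^ k * x ^ (2 * k + 1) / fact (2 * k + 1))"

definition cos_poly :: "nat \<Rightarrow> real \<Rightarrow> real" where
  "cos_poly n x = (\<Sum>k<n. (-1) ^ k * x ^ (2 * k) / fact (2 * k))"

lemma has_derivative_sin_poly: "(sin_poly n has_real_derivative cos_poly n x) (at x)"
proof -
  have "((\<lambda>x. (-1) ^ k * x ^ (2 * k + 1) / fact (2 * k + 1)) has_real_derivative
      (-1) ^ k * x ^ (2 * k) / fact (2 * k)) (at x)" for k
  proof (rule DERIV_cong, rule DERIV_cdivide, rule DERIV_cmult, rule DERIV_pow)
    have "fact (2 * k + 1) = real (2 * k + 1) * fact (2 * k)"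
      by simp
    then show "(-1) ^ k * (real (2 * k + 1) * x ^ (2 * k + 1 - Suc 0)) / fact (2 * k + 1) =
        (-1) ^ k * x ^ (2 * k) / fact (2 * k)"
      by (simp only:) simp
  qed
  then show ?thesis
    unfolding sin_poly_def cos_poly_def by (intro DERIV_sum)
qed

lemma has_derivative_cos_poly: "(cos_poly (Suc n) has_real_derivative - sin_poly n x) (at x)"
proof -
  have "((\<lambda>x. (-1) ^ Suc k * x ^ (2 * Suc k) / fact (2 * Suc k)) has_real_derivative
      - ((-1) ^ k * x ^ (2 * k + 1) / fact (2 * k + 1))) (at x)" for k
  proof (rule DERIV_cong, rule DERIV_cdivide, rule DERIV_cmult, rule DERIV_pow)
    have "fact (2 * Suc k) = real (2 * Suc k) * fact (2 * k + 1)"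
      by simp
    then show "(-1) ^ Suc k * (real (2 * Suc k) * x ^ (2 * Suc k - Suc 0)) / fact (2 * Suc k) =
        - ((-1) ^ k * x ^ (2 * k + 1) / fact (2 * k + 1))"
      by (simp only:) simp
  qed
  then have "((\<lambda>x. \<Sum>k<n. (-1) ^ Suc k * x ^ (2 * Suc k) / fact (2 * Suc k)) has_real_derivative
      - sin_poly n x) (at x)"
    unfolding sin_poly_def sum_negf[symmetric] by (intro DERIV_sum)
  then have "((\<lambda>x. 1 + (\<Sum>k<n. (-1) ^ Suc k * x ^ (2 * Suc k) / fact (2 * Suc k))) has_real_derivative
      0 + - sin_poly n x) (at x)"
    by (intro DERIV_add DERIV_const)
  then show ?thesis
    unfolding cos_poly_def sum.lessThan_Suc_shift by simp
qed

lemma nonneg_if_deriv_nonneg: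
  fixes f :: "real \<Rightarrow> real"
  assumes "\<And>y. (f has_real_derivative f' y) (at y)" "\<And>y. y \<ge> 0 \<Longrightarrow> f' y \<ge> 0" "f 0 \<ge> 0" "x \<ge> 0"
  shows "f x \<ge> 0"
  using DERIV_nonneg_imp_nondecreasing[of 0 x f] assms by force

text \<open>Integration from 0 preserves the sign of a remainder: the estimate for cos yields the
  one for sin with equally many terms, and that one yields the estimate for cos with one more term.
  The chain starts at \<open>cos x \<le> 1\<close>. Since \<open>x\<close> may be any nonnegative
  number, the bounds apply at \<open>2 * t\<close> and \<open>3 * t\<close> as well.\<close>

lemma alternating_taylor:
  assumes "x \<ge> 0"
  shows "(-1) ^ Suc n * (cos x - cos_poly (Suc n) x) \<ge> 0"
    and "(-1) ^ Suc n * (sin x - sin_poly (Suc n) x) \<ge> 0"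
proof -
  have sin: "(-1) ^ Suc n * (sin x - sin_poly (Suc n) x) \<ge> 0"
    if cos: "\<And>y. y \<ge> 0 \<Longrightarrow> (-1) ^ Suc n * (cos y - cos_poly (Suc n) y) \<ge> 0" and "x \<ge> 0" for n x
  proof (rule nonneg_if_deriv_nonneg[OF _ cos _ \<open>x \<ge> 0\<close>])
    show "((\<lambda>y. (-1) ^ Suc n * (sin y - sin_poly (Suc n) y)) has_real_derivative
        (-1) ^ Suc n * (cos y - cos_poly (Suc n) y)) (at y)" for y
      by (intro DERIV_cmult DERIV_diff DERIV_sin has_derivative_sin_poly)
    show "0 \<le> (-1) ^ Suc n * (sin 0 - sin_poly (Suc n) 0)"
      by (simp add: sin_poly_def)
  qed
  have cos: "(-1) ^ Suc n * (cos x - cos_poly (Suc n) x) \<ge> 0" if "x \<ge> 0" for n x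
    using that
  proof (induction n arbitrary: x)
    case 0
    show ?case by (simp add: cos_poly_def)
  next
    case (Suc n)
    have "((\<lambda>y. (-1) ^ Suc (Suc n) * (cos y - cos_poly (Suc (Suc n)) y)) has_real_derivative
        (-1) ^ Suc n * (sin y - sin_poly (Suc n) y)) (at y)" for y
      by (rule DERIV_cong, rule DERIV_cmult, rule DERIV_diff, rule DERIV_cos, rule has_derivative_cos_poly)
         (simp add: algebra_simps)
    then show ?case
    proof (rule nonneg_if_deriv_nonneg[OF _ sin[OF Suc.IH] _ \<open>x \<ge> 0\<close>])
      show "0 \<le> (-1) ^ Suc (Suc n) * (cos 0 - cos_poly (Suc (Suc n)) 0)"
        unfolding cos_poly_def sum.lessThan_Suc_shift by simp
    qed
  qed
  show "(-1) ^ Suc n * (cos x - cos_poly (Suc n) x) \<ge> 0"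
    by (rule cos[OF assms])
  show "(-1) ^ Suc n * (sin x - sin_poly (Suc n) x) \<ge> 0"
    by (rule sin[OF cos assms])
qed

lemma sin_le_poly: "odd n \<Longrightarrow> x \<ge> 0 \<Longrightarrow> sin x \<le> sin_poly n x"
  using alternating_taylor(2)[of x "n - 1"] by (cases n) auto

lemma sin_ge_poly: "even n \<Longrightarrow> n > 0 \<Longrightarrow> x \<ge> 0 \<Longrightarrow> sin_poly n x \<le> sin x"
  using alternating_taylor(2)[of x "n - 1"] by (cases n) auto

lemma cos_le_poly: "odd n \<Longrightarrow> x \<ge> 0 \<Longrightarrow> cos x \<le> cos_poly n x"
  using alternating_taylor(1)[of x "n - 1"] by (cases n) auto

lemma cos_ge_poly: "even n \<Longrightarrow> n > 0 \<Longrightarrow> x \<ge> 0 \<Longrightarrow> cos_poly n x \<le> cos x"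
  using alternating_taylor(1)[of x "n - 1"] by (cases n) auto

lemma pi_half_less: "pi / 2 < 8 / 5"
proof -
  \<comment> \<open>Five terms already make the upper bound negative at 8/5, whereas cos is
    nonnegative up to \<open>pi / 2\<close>.\<close>
  have "cos (8 / 5) < (0::real)"
    using cos_le_poly[of 5 "8/5"]
    by (simp add: cos_poly_def lessThan_nat_numeral fact_numeral power_divide)
  then show ?thesis
    using cos_ge_zero[of "8/5"] by linarith
qed

text \<open>Serves twice: to keep \<open>2 * t / sqrt 3\<close> below \<open>pi\<close>, and in the
  estimate \<open>exp 1 * pi > 8\<close> behind \<open>2 < beta_exp\<close>.\<close>

lemma pi_gt_three: "3 < pi"
proof -
  have "0 < cos (3 / 2 :: real)"
    using cos_ge_poly[of 4 "3/2"]
    by (simp add: cos_poly_def lessThan_nat_numeral fact_numeral power_divide)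
  then have "\<not> pi / 2 \<le> 3 / 2"
    using cos_monotone_0_pi_le[of "pi/2" "3/2"] pi_half_gt_zero pi_ge_two by auto
  then show ?thesis by linarith
qed

section \<open>Two trigonometric inequalities\<close>

text \<open>Instantiated at one fixed variable, these rules move coefficients to the front and merge
  powers. With \<open>poly_expand\<close> and \<open>fraction_expand\<close> they bring the
  high-degree polynomial identities below to a normal form.\<close>

lemma monomial_simps:
  fixes t z :: real
  shows "t * t = t\<^sup>2" "t * t ^ n = t ^ Suc n" "t ^ n * t = t ^ Suc n" "t ^ m * t ^ n = t ^ (m + n)"
    "t * (numeral w * z) = numeral w * (t * z)" "t ^ n * (numeral w * z) = numeral w * (t ^ n * z)"
    "t * numeral w = numeral w * t" "t ^ n * numeral w = numeral w * t ^ n"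
  by (simp_all add: power_add power2_eq_square)

lemmas poly_expand = distrib_left distrib_right left_diff_distrib right_diff_distrib
  power_mult[symmetric] times_divide_eq_right times_divide_eq_left mult_1_right
  power_Suc0_right Suc_numeral add_num_simps numeral_plus_numeral mult_num_simps
  numeral_times_numeral mult.assoc

lemmas fraction_expand = add_divide_distrib diff_divide_distrib divide_divide_eq_left
  divide_divide_eq_right times_divide_eq_left times_divide_eq_right

lemma poly_eqs:
  fixes t :: real
  shows "sin_poly 3 t = t - t ^ 3 / 6 + t ^ 5 / 120"
    "sin_poly 4 t = t - t ^ 3 / 6 + t ^ 5 / 120 - t ^ 7 / 5040"
    "sin_poly 5 t = t - t ^ 3 / 6 + t ^ 5 / 120 - t ^ 7 / 5040 + t ^ 9 / 362880"
    "sin_poly 5 (2 * t) = 2 * t - 4 * t ^ 3 / 3 + 4 * t ^ 5 / 15 - 8 * t ^ 7 / 315 + 4 * t ^ 9 / 2835"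
    "sin_poly 6 t = t - t ^ 3 / 6 + t ^ 5 / 120 - t ^ 7 / 5040 + t ^ 9 / 362880 - t ^ 11 / 39916800"
    "sin_poly 6 (2 * t) = 2 * t - 4 * t ^ 3 / 3 + 4 * t ^ 5 / 15 - 8 * t ^ 7 / 315 + 4 * t ^ 9 / 2835 - 8 * t ^ 11 / 155925"
    "sin_poly 6 (3 * t) = 3 * t - 9 * t ^ 3 / 2 + 81 * t ^ 5 / 40 - 243 * t ^ 7 / 560 + 243 * t ^ 9 / 4480 - 2187 * t ^ 11 / 492800"
    "sin_poly 7 (3 * t) = 3 * t - 9 * t ^ 3 / 2 + 81 * t ^ 5 / 40 - 243 * t ^ 7 / 560 + 243 * t ^ 9 / 4480 - 2187 * t ^ 11 / 492800 + 6561 * t ^ 13 / 25625600"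
    "cos_poly 3 t = 1 - t ^ 2 / 2 + t ^ 4 / 24"
    "cos_poly 5 t = 1 - t ^ 2 / 2 + t ^ 4 / 24 - t ^ 6 / 720 + t ^ 8 / 40320"
    "cos_poly 6 t = 1 - t ^ 2 / 2 + t ^ 4 / 24 - t ^ 6 / 720 + t ^ 8 / 40320 - t ^ 10 / 3628800"
    "cos_poly 6 (2 * t) = 1 - 2 * t ^ 2 + 2 * t ^ 4 / 3 - 4 * t ^ 6 / 45 + 2 * t ^ 8 / 315 - 4 * t ^ 10 / 14175"
    "cos_poly 8 (3 * t) = 1 - 9 * t ^ 2 / 2 + 27 * t ^ 4 / 8 - 81 * t ^ 6 / 80 + 729 * t ^ 8 / 4480 - 729 * t ^ 10 / 44800 + 2187 * t ^ 12 / 1971200 - 19683 * t ^ 14 / 358758400"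
  unfolding sin_poly_def cos_poly_def
  by (simp_all add: lessThan_nat_numeral fact_numeral power_mult_distrib power_Suc[of t, symmetric]
      del: power_Suc)

text \<open>With \<open>cos_sin_squared\<close> and the double-angle formulas this trades powers for
  multiple angles. Each trigonometric factor then occurs linearly, and the sign in front of it
  selects the Taylor bound to use.\<close>

lemma sin_cubed: "(sin x) ^ 3 = 3 / 4 * sin x - sin (3 * x) / 4" for x :: real
proof -
  have "sin (3 * x) = sin (2 * x + x)" by simp
  also have "\<dots> = 2 * sin x * (cos x)\<^sup>2 + (1 - 2 * (sin x)\<^sup>2) * sin x"
    unfolding sin_add sin_double cos_double_sin by (simp add: power2_eq_square)
  finally have "sin (3 * x) = 3 * sin x - 4 * (sin x) ^ 3"
    unfolding cos_squared_eq by (simp add: power2_eq_square power3_eq_cube algebra_simps)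
  then show ?thesis
    by linarith
qed

lemma cos_sin_squared: "cos x * (sin x)\<^sup>2 = (cos x - cos (3 * x)) / 4" for x :: real
  unfolding sin_squared_eq cos_treble_cos by (simp add: power2_eq_square power3_eq_cube algebra_simps)

text \<open>\<open>log_h_deriv2 t * sin t < log_h_deriv t\<close> with denominators cleared.\<close>
lemma trig_poly_ineq_half:
  fixes t :: real
  assumes "0 < t" "t < 8 / 5"
  shows "t * (sin t)\<^sup>2 + t ^ 3 - 2 * t\<^sup>2 * (cos t * sin t)
    < 3 * t\<^sup>2 * sin t - (sin t) ^ 3 - 2 * t ^ 3 * cos t"
proof -
  have taylor: "sin t \<le> sin_poly 3 t" "sin_poly 4 t \<le> sin t" "sin_poly 6 (3 * t) \<le> sin (3 * t)"
     "cos t \<le> cos_poly 3 t" "cos_poly 6 (2 * t) \<le> cos (2 * t)" "sin_poly 6 (2 * t) \<le> sin (2 * t)"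
    using assms by (auto intro!: sin_le_poly sin_ge_poly cos_le_poly cos_ge_poly)
  define y where "y = t\<^sup>2"
  have y: "0 < y" "y < 64 / 25"
    using assms power_strict_mono[of t "8/5" 2] by (auto simp: power_divide y_def)
  \<comment> \<open>What the truncated expression leaves: all powers below \<open>t ^ 7\<close>
    cancel, and the remaining factor is a cubic in \<open>y\<close>. It is grouped in pairs, each
    positive for \<open>y < 64/25 = (8/5)^2\<close>.\<close>
  have "0 < 1117/20160 - 1493/161280 * y + y^2 * (569/3548160 - 8/155925 * y)"
    using y by (intro add_pos_pos mult_pos_pos) auto
  then have "0 < t ^ 7 * (1117/20160 - 1493/161280 * y + y^2 * (569/3548160 - 8/155925 * y))"
    using assms by simp
  also have "\<dots> = sin_poly 6 (3 * t) / 4 - 3/4 * sin_poly 3 t + 3 * (t\<^sup>2 * sin_poly 4 t)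
      - 2 * (t ^ 3 * cos_poly 3 t) - t / 2 + t * cos_poly 6 (2 * t) / 2 - t ^ 3 + t\<^sup>2 * sin_poly 6 (2 * t)"
    unfolding poly_eqs[where t = t] y_def
    by (simp only: monomial_simps[where t = t] poly_expand) (simp only: fraction_expand)
  \<comment> \<open>Terms with a positive sign were given lower Taylor bounds, terms with a negative
    sign upper ones.\<close>
  also have "\<dots> \<le> sin (3 * t) / 4 - 3/4 * sin t + 3 * (t\<^sup>2 * sin t)
      - 2 * (t ^ 3 * cos t) - t / 2 + t * cos (2 * t) / 2 - t ^ 3 + t\<^sup>2 * sin (2 * t)"
    using assms by (intro diff_mono add_mono taylor mult_left_mono divide_right_mono mult_left_mono_neg) auto
  also have "\<dots> = 3 * t\<^sup>2 * sin t - (sin t) ^ 3 - 2 * t ^ 3 * cos t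
      - (t * (sin t)\<^sup>2 + t ^ 3 - 2 * t\<^sup>2 * (cos t * sin t))"
    unfolding sin_cubed cos_double_sin sin_double by (simp add: field_simps)
  finally show ?thesis by simp
qed

text \<open>The analogue for \<open>ln (cos (t / sqrt 3))\<close>. The Taylor polynomial \<open>S'\<close> of
  \<open>sqrt 3 / 2 * sin (2 t / sqrt 3)\<close> has rational coefficients.\<close>
lemma trig_poly_ineq_sqrt3:
  fixes t :: real
  assumes "0 < t" "t < 8 / 5"
    and nonneg: "3 * t\<^sup>2 * sin t - (sin t) ^ 3 - 2 * t ^ 3 * cos t \<ge> 0"
  shows "(sqrt 3 / 2 * sin (2 * (t / sqrt 3))) * (3 * t\<^sup>2 * sin t - (sin t) ^ 3 - 2 * t ^ 3 * cos t)
      < t * (sin t) ^ 3 + t ^ 3 * sin t - 2 * t\<^sup>2 * (cos t * (sin t)\<^sup>2)"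
proof -
  define S where "S = sqrt 3 / 2 * sin (2 * (t / sqrt 3))"
  define S' where "S' = t - 2/9 * t^3 + 2/135 * t^5 - 4/8505 * t^7 + 2/229635 * t^9"
  define M where "M = 3 * t\<^sup>2 * sin t - (sin t) ^ 3 - 2 * t ^ 3 * cos t"
  define M' where "M' = sin_poly 7 (3 * t) / 4 - 3/4 * sin_poly 6 t + 3 * (t\<^sup>2 * sin_poly 5 t) - 2 * (t ^ 3 * cos_poly 6 t)"
  define y where "y = t\<^sup>2"
  have y: "0 < y" "y < 64 / 25"
    using assms power_strict_mono[of t "8/5" 2] by (auto simp: power_divide y_def)
  have taylor: "sin t \<le> sin_poly 5 t" "sin_poly 6 t \<le> sin t" "sin (3 * t) \<le> sin_poly 7 (3 * t)"
     "cos t \<le> cos_poly 5 t" "cos_poly 6 t \<le> cos t" "cos_poly 8 (3 * t) \<le> cos (3 * t)"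
    using assms by (auto intro!: sin_le_poly sin_ge_poly cos_le_poly cos_ge_poly)
  \<comment> \<open>Here every power below \<open>t ^ 12\<close> cancels. A polynomial of degree
    five in \<open>y\<close> is left, again grouped in pairs that are positive for
    \<open>y < 64/25\<close>.\<close>
  have "0 < 13/23040 - 5039761/33625912320 * y + y^2 * (69625001/5431878144000 - 519469543/317764871424000 * y)
      + y^4 * (2138867/52960811904000 - 536017/953294614272000 * y)"
    using y by (intro add_pos_pos mult_pos_pos) auto
  then have "0 < t ^ 12 * (13/23040 - 5039761/33625912320 * y + y^2 * (69625001/5431878144000 - 519469543/317764871424000 * y)
      + y^4 * (2138867/52960811904000 - 536017/953294614272000 * y))"
    using assms by simp
  also have "\<dots> = 3/4 * (t * sin_poly 6 t) - t * sin_poly 7 (3 * t) / 4 + t ^ 3 * sin_poly 6 t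
      - t\<^sup>2 * cos_poly 5 t / 2 + t\<^sup>2 * cos_poly 8 (3 * t) / 2 - S' * M'"
    unfolding poly_eqs[where t = t] y_def S'_def M'_def
    by (simp only: monomial_simps[where t = t] poly_expand) (simp only: fraction_expand)
  also have "\<dots> \<le> 3/4 * (t * sin t) - t * sin (3 * t) / 4 + t ^ 3 * sin t
      - t\<^sup>2 * cos t / 2 + t\<^sup>2 * cos (3 * t) / 2 - S' * M'"
    using assms
    by (intro diff_right_mono) (intro diff_mono add_mono taylor mult_left_mono divide_right_mono, auto)
  also have "\<dots> = t * (sin t) ^ 3 + t ^ 3 * sin t - 2 * t\<^sup>2 * (cos t * (sin t)\<^sup>2) - S' * M'"
    unfolding sin_cubed cos_sin_squared by (simp add: right_diff_distrib diff_divide_distrib mult.commute mult.left_commute)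
  finally have *: "S' * M' < t * (sin t) ^ 3 + t ^ 3 * sin t - 2 * t\<^sup>2 * (cos t * (sin t)\<^sup>2)"
    by simp
  have "S \<le> sqrt 3 / 2 * sin_poly 5 (2 * (t / sqrt 3))"
    unfolding S_def using assms by (intro mult_left_mono sin_le_poly) auto
  also have "\<dots> = S'"
  proof -
    define u where "u = t / sqrt 3"
    have u: "sqrt 3 * u = t" "u\<^sup>2 = t\<^sup>2 / 3"
      by (auto simp: u_def power_divide)
    \<comment> \<open>An odd polynomial in \<open>u\<close> is \<open>u\<close> times a polynomial
      in \<open>u^2\<close>; then \<open>sqrt 3 * u = t\<close> and \<open>u^2 = t^2 / 3\<close>
      remove the square root.\<close>
    have "sin_poly 5 (2 * u) = 2 * (u *
        (1 - 2/3 * u\<^sup>2 + 2/15 * (u\<^sup>2)^2 - 4/315 * (u\<^sup>2)^3 + 2/2835 * (u\<^sup>2)^4))"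
      unfolding poly_eqs[where t = u] by (simp only: monomial_simps[where t = u] poly_expand)
    then have "sqrt 3 / 2 * sin_poly 5 (2 * u) = (sqrt 3 * u) *
        (1 - 2/3 * u\<^sup>2 + 2/15 * (u\<^sup>2)^2 - 4/315 * (u\<^sup>2)^3 + 2/2835 * (u\<^sup>2)^4)"
      by simp
    also have "\<dots> = S'"
      unfolding u S'_def power_divide by (simp only: monomial_simps[where t = t] poly_expand) (simp add: fraction_expand)
    finally show ?thesis
      by (simp add: u_def)
  qed
  finally have "S \<le> S'" .
  moreover have "M \<le> M'"
  proof -
    have "M = sin (3 * t) / 4 - 3/4 * sin t + 3 * (t\<^sup>2 * sin t) - 2 * (t ^ 3 * cos t)"
      unfolding M_def sin_cubed by simp
    also have "\<dots> \<le> M'"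
      unfolding M'_def
      using assms by (intro diff_mono add_mono taylor mult_left_mono divide_right_mono mult_left_mono_neg) auto
    finally show ?thesis .
  qed
  \<comment> \<open>Multiplying \<open>S \<le> S'\<close> by \<open>M \<le> M'\<close> requires
    signs. That of \<open>M\<close> is assumed; that of \<open>S\<close> holds because the argument
    of sin stays below \<open>3 < pi\<close>.\<close>
  moreover have "0 \<le> S"
  proof -
    have "3 / 2 \<le> sqrt (3::real)"
      by (rule real_le_rsqrt) (simp add: power_divide)
    then have "2 * (t / sqrt 3) < 3"
      using assms by (simp add: field_simps)
    then have "0 \<le> sin (2 * (t / sqrt 3))"
      using assms pi_gt_three by (intro sin_ge_zero) auto
    then show ?thesis
      unfolding S_def by simp
  qed
  ultimately have "S * M \<le> S' * M'"
    using nonneg unfolding M_def[symmetric] by (intro mult_mono) auto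
  with * show ?thesis unfolding S_def M_def by simp
qed

section \<open>Monotone form of the rule of l'Hopital\<close>

text \<open>The limit at 0 is at most \<open>f (x / 2)\<close>, and the step from
  \<open>x / 2\<close> to \<open>x\<close> makes the bound strict. Positivity of the derivative is
  asked only on the open interval because in \<open>lhopital_strict_mono\<close> the derivative
  vanishes at the right end. A limit replaces the value at 0, where formulas with division take
  default values.\<close>

lemma pos_of_deriv_pos:
  fixes f :: "real \<Rightarrow> real"
  assumes deriv: "\<And>x. x \<in> {0<..b} \<Longrightarrow> (f has_real_derivative f' x) (at x)"
    and pos: "\<And>x. x \<in> {0<..<b} \<Longrightarrow> f' x > 0"
    and lim: "(f \<longlongrightarrow> 0) (at_right 0)" and "x \<in> {0<..b}"
  shows "f x > 0"
proof -
  have mono: "f u < f v" if "0 < u" "u < v" "v \<le> b" for u v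
  proof (rule DERIV_pos_imp_increasing_open[OF \<open>u < v\<close>])
    show "\<exists>y. DERIV f z :> y \<and> 0 < y" if "u < z" "z < v" for z
      using deriv[of z] pos[of z] that \<open>0 < u\<close> \<open>v \<le> b\<close> by fastforce
    show "continuous_on {u..v} f"
      using deriv \<open>0 < u\<close> \<open>v \<le> b\<close>
      by (intro continuous_at_imp_continuous_on ballI DERIV_isCont[OF deriv]) auto
  qed
  have "eventually (\<lambda>u. f u \<le> f (x / 2)) (at_right 0)"
    using mono[of _ "x/2"] assms(4)
    by (intro eventually_at_rightI[of 0 "x/2"]) (auto intro!: less_imp_le)
  then have "0 \<le> f (x / 2)"
    by (intro tendsto_upperbound[OF lim]) auto
  then show ?thesis using mono[of "x/2" x] assms(4) by auto
qed

text \<open>The hypothesis \<open>less\<close> is positivity of the numerator of the derivative of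
  \<open>f' / g'\<close>, so that quotient increases; the vanishing limits carry this over to
  \<open>f / g\<close>.\<close>

lemma lhopital_strict_mono:
  fixes f g :: "real \<Rightarrow> real"
  assumes f: "\<And>x. x \<in> {0<..b} \<Longrightarrow> (f has_real_derivative f' x) (at x)"
    and g: "\<And>x. x \<in> {0<..b} \<Longrightarrow> (g has_real_derivative g' x) (at x)"
    and f2: "\<And>x. x \<in> {0<..b} \<Longrightarrow> (f' has_real_derivative f'' x) (at x)"
    and g2: "\<And>x. x \<in> {0<..b} \<Longrightarrow> (g' has_real_derivative g'' x) (at x)"
    and g'_pos: "\<And>x. x \<in> {0<..b} \<Longrightarrow> g' x > 0"
    and less: "\<And>x. x \<in> {0<..b} \<Longrightarrow> f' x * g'' x < f'' x * g' x"
    and limf: "(f \<longlongrightarrow> 0) (at_right 0)" and limg: "(g \<longlongrightarrow> 0) (at_right 0)"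
  shows "strict_mono_on {0<..b} (\<lambda>x. f x / g x)"
proof -
  have increasing: "strict_mono_on {0<..b} h"
    if h: "\<And>x. x \<in> {0<..b} \<Longrightarrow> (h has_real_derivative h' x) (at x)"
      and pos: "\<And>x. x \<in> {0<..b} \<Longrightarrow> h' x > 0" for h h' :: "real \<Rightarrow> real"
  proof (rule strict_mono_onI)
    fix u v assume uv: "u \<in> {0<..b}" "v \<in> {0<..b}" "u < v"
    show "h u < h v"
    proof (rule DERIV_pos_imp_increasing[OF \<open>u < v\<close>])
      show "\<exists>y. DERIV h z :> y \<and> 0 < y" if "u \<le> z" "z \<le> v" for z
        using h[of z] pos[of z] that uv by force
    qed
  qed
  have mono: "strict_mono_on {0<..b} (\<lambda>x. f' x / g' x)"
  proof (rule increasing)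
    fix x assume x: "x \<in> {0<..b}"
    show "((\<lambda>x. f' x / g' x) has_real_derivative (f'' x * g' x - f' x * g'' x) / (g' x * g' x)) (at x)"
      using g'_pos[OF x] by (intro DERIV_divide f2 g2 x) auto
    show "0 < (f'' x * g' x - f' x * g'' x) / (g' x * g' x)"
      using g'_pos[OF x] less[OF x] by auto
  qed
  have g_pos: "g x > 0" if "x \<in> {0<..b}" for x
    by (rule pos_of_deriv_pos[OF g g'_pos limg that]) auto
  show ?thesis
  proof (rule increasing)
    fix x assume x: "x \<in> {0<..b}"
    show "((\<lambda>x. f x / g x) has_real_derivative (f' x * g x - f x * g' x) / (g x * g x)) (at x)"
      using g_pos[OF x] by (intro DERIV_divide f g x) auto
    \<comment> \<open>Since \<open>f' / g' < c\<close> to the left of \<open>x\<close>, the function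
      \<open>c * g - f\<close> has positive derivative there and limit 0 at 0. Its positivity at
      \<open>x\<close> is \<open>f x * g' x < f' x * g x\<close>, the sign of the numerator
      sought.\<close>
    define c where "c = f' x / g' x"
    have "0 < c * g x - f x"
    proof (rule pos_of_deriv_pos[where f = "\<lambda>z. c * g z - f z" and f' = "\<lambda>z. c * g' z - f' z" and b = x])
      fix z assume "z \<in> {0<..<x}"
      then have "f' z / g' z < c"
        using strict_mono_onD[OF mono, of z x] x by (auto simp: c_def)
      then show "0 < c * g' z - f' z"
        using g'_pos[of z] x \<open>z \<in> {0<..<x}\<close> by (auto simp: field_simps)
    next
      show "((\<lambda>z. c * g z - f z) \<longlongrightarrow> 0) (at_right 0)"
        using tendsto_diff[OF tendsto_mult_left[OF limg, of c] limf] by simp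
      next
      fix z assume "z \<in> {0<..x}"
      then show "((\<lambda>z. c * g z - f z) has_real_derivative c * g' z - f' z) (at z)"
        using x by (intro DERIV_diff DERIV_cmult f g) auto
    qed (use x in auto)
    then show "0 < (f' x * g x - f x * g' x) / (g x * g x)"
      using g_pos[OF x] g'_pos[OF x] by (auto simp: c_def field_simps)
  qed
qed

lemma strict_mono_on_less_limit:
  fixes f :: "real \<Rightarrow> real"
  assumes "strict_mono_on {0<..b} f" "(f \<longlongrightarrow> l) (at_right 0)" "x \<in> {0<..b}"
  shows "l < f x"
proof -
  have "eventually (\<lambda>u. f u \<le> f (x / 2)) (at_right 0)"
    using assms strict_mono_onD[OF assms(1), of _ "x/2"]
    by (intro eventually_at_rightI[of 0 "x/2"]) (auto intro!: less_imp_le)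
  then have "l \<le> f (x / 2)"
    by (intro tendsto_upperbound[OF assms(2)]) auto
  then show ?thesis using strict_mono_onD[OF assms(1), of "x/2" x] assms(3) by auto
qed

section \<open>The logarithm of h\<close>

text \<open>Twice the logarithm of \<open>h_fun\<close>, see \<open>h_fun_eq_exp\<close>.\<close>
definition log_h :: "real \<Rightarrow> real" where
  "log_h t = ln (sin t / t) + t * cot t - 1"

definition log_h_deriv :: "real \<Rightarrow> real" where
  "log_h_deriv t = 2 * cot t - 1 / t - t / (sin t)\<^sup>2"

definition log_h_deriv2 :: "real \<Rightarrow> real" where
  "log_h_deriv2 t = 1 / t\<^sup>2 - 3 / (sin t)\<^sup>2 + 2 * t * cos t / (sin t) ^ 3"

lemma h_fun_eq_exp:
  assumes "0 < t" "t < pi"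
  shows "h_fun t = exp (log_h t / 2)"
proof -
  have "sin t / t > 0"
    using assms sin_gt_zero by simp
  then have "sin t / t * exp (t * cot t - 1) = exp (log_h t)"
    by (simp add: log_h_def exp_add exp_diff)
  also have "\<dots> = (exp (log_h t / 2))\<^sup>2"
    by (simp flip: exp_double)
  finally show ?thesis
    by (simp add: h_fun_def)
qed

lemma DERIV_log_h:
  assumes "0 < t" "t < pi"
  shows "(log_h has_real_derivative log_h_deriv t) (at t)"
proof -
  have s: "sin t > 0"
    using assms sin_gt_zero by simp
  have "((\<lambda>t. sin t / t) has_real_derivative (cos t * t - sin t * 1) / (t * t)) (at t)"
    using assms by (intro DERIV_divide DERIV_sin DERIV_ident) auto
  then have 1: "((\<lambda>t. ln (sin t / t)) has_real_derivative
      inverse (sin t / t) * ((cos t * t - sin t * 1) / (t * t))) (at t)"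
    using s assms by (intro DERIV_chain2[OF DERIV_ln]) auto
  have 2: "((\<lambda>t. t * cot t) has_real_derivative 1 * cot t + - inverse ((sin t)\<^sup>2) * t) (at t)"
    using s by (intro DERIV_mult DERIV_ident DERIV_cot) auto
  show ?thesis
    unfolding log_h_def
    by (rule DERIV_cong[OF DERIV_diff[OF DERIV_add[OF 1 2] DERIV_const]])
       (use s assms in \<open>simp add: log_h_deriv_def cot_def field_simps power2_eq_square\<close>)
qed

lemma DERIV_log_h_deriv:
  assumes "0 < t" "t < pi"
  shows "(log_h_deriv has_real_derivative log_h_deriv2 t) (at t)"
proof -
  have "sin t > 0"
    using assms sin_gt_zero by simp
  then show ?thesis
    unfolding log_h_deriv_def log_h_deriv2_def using assms
    by (auto intro!: derivative_eq_intros DERIV_cot[THEN DERIV_chain2] simp: field_simps power2_eq_square power3_eq_cube)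
qed

text \<open>Multiplication by \<open>- t * (sin t)^2\<close> turns the derivative into
  \<open>(sin t)^2 + t^2 - 2 * t * sin t * cos t\<close>, which is a square plus a positive
  term.\<close>

lemma log_h_deriv_neg:
  assumes "0 < t" "t < pi"
  shows "log_h_deriv t < 0"
proof -
  have s: "sin t > 0"
    using assms sin_gt_zero by simp
  have "cos t < 1"
    using assms cos_monotone_0_pi[of 0 t] by simp
  then have "0 < 2 * t * sin t * (1 - cos t) + (sin t - t)\<^sup>2"
    using assms s by (intro add_pos_nonneg mult_pos_pos) auto
  also have "\<dots> = - log_h_deriv t * (t * (sin t)\<^sup>2)"
    using assms s by (simp add: log_h_deriv_def cot_def field_simps power2_eq_square)
  finally show ?thesis
    using assms s by (simp add: zero_less_mult_iff mult_less_0_iff)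
qed

text \<open>For \<open>g t = - ln (cos (c * t))\<close> one has
  \<open>g' / g'' = sin (2 * c * t) / (2 * c)\<close>. This is \<open>sin t\<close> for
  \<open>c = 1/2\<close> and the factor in the second bound for \<open>c = 1 / sqrt 3\<close>. The
  two bounds are thus the l'Hopital conditions for the two quotients, in opposite
  directions.\<close>

lemma log_h_deriv2_bounds:
  assumes "0 < t" "t \<le> pi / 2"
  shows "log_h_deriv2 t * sin t < log_h_deriv t"
    and "log_h_deriv t < log_h_deriv2 t * (sqrt 3 / 2 * sin (2 * (t / sqrt 3)))"
proof -
  have s: "sin t > 0"
    using assms sin_gt_zero by simp
  have t: "t < 8 / 5"
    using assms pi_half_less by linarith
  have pos: "t\<^sup>2 * (sin t)\<^sup>2 > 0" "t\<^sup>2 * (sin t) ^ 3 > 0"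
    using assms s by auto
  have d1: "log_h_deriv t * (t\<^sup>2 * (sin t)\<^sup>2) = - (t * (sin t)\<^sup>2 + t ^ 3 - 2 * t\<^sup>2 * (cos t * sin t))"
    using assms s by (simp add: log_h_deriv_def cot_def field_simps power2_eq_square power3_eq_cube)
  have d2: "log_h_deriv2 t * (t\<^sup>2 * (sin t) ^ 3) = - (3 * t\<^sup>2 * sin t - (sin t) ^ 3 - 2 * t ^ 3 * cos t)"
    using assms s by (simp add: log_h_deriv2_def field_simps power2_eq_square power3_eq_cube)
  have "log_h_deriv2 t * sin t * (t\<^sup>2 * (sin t)\<^sup>2) < log_h_deriv t * (t\<^sup>2 * (sin t)\<^sup>2)"
    using trig_poly_ineq_half[OF assms(1) t] d1 d2 by (simp add: power2_eq_square power3_eq_cube mult_ac)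
  then show *: "log_h_deriv2 t * sin t < log_h_deriv t"
    using pos mult_less_cancel_right_pos by blast
  \<comment> \<open>The first bound and \<open>log_h_deriv t < 0\<close> make the second derivative
    negative, which is the sign hypothesis of \<open>trig_poly_ineq_sqrt3\<close>.\<close>
  have "log_h_deriv2 t * sin t < 0"
    using * log_h_deriv_neg[of t] assms by simp
  then have "log_h_deriv2 t * (t\<^sup>2 * (sin t) ^ 3) \<le> 0"
    using s pos by (simp add: mult_less_0_iff mult_le_0_iff)
  then have "0 \<le> 3 * t\<^sup>2 * sin t - (sin t) ^ 3 - 2 * t ^ 3 * cos t"
    using d2 by simp
  note trig_poly_ineq_sqrt3[OF assms(1) t this]
  moreover have "log_h_deriv t * (t\<^sup>2 * (sin t) ^ 3) = - (t * (sin t) ^ 3 + t ^ 3 * sin t - 2 * t\<^sup>2 * (cos t * (sin t)\<^sup>2))"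
    using arg_cong[OF d1, of "\<lambda>x. x * sin t"]
    by (simp add: algebra_simps power2_eq_square power3_eq_cube)
  moreover have "log_h_deriv2 t * (sqrt 3 / 2 * sin (2 * (t / sqrt 3))) * (t\<^sup>2 * (sin t) ^ 3) =
      - (sqrt 3 / 2 * sin (2 * (t / sqrt 3)) * (3 * t\<^sup>2 * sin t - (sin t) ^ 3 - 2 * t ^ 3 * cos t))"
    using arg_cong[OF d2, of "\<lambda>x. x * (sqrt 3 / 2 * sin (2 * (t / sqrt 3)))"]
    by (simp only: mult_ac mult_minus_left mult_minus_right)
  ultimately have "log_h_deriv t * (t\<^sup>2 * (sin t) ^ 3)
      < log_h_deriv2 t * (sqrt 3 / 2 * sin (2 * (t / sqrt 3))) * (t\<^sup>2 * (sin t) ^ 3)"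
    by linarith
  then show "log_h_deriv t < log_h_deriv2 t * (sqrt 3 / 2 * sin (2 * (t / sqrt 3)))"
    using pos mult_less_cancel_right_pos by blast
qed

section \<open>The function ln (cos (c t)): derivatives and behaviour at 0\<close>

lemma DERIV_ln_cos:
  assumes "cos (c * t) > 0"
  shows "((\<lambda>t. - ln (cos (c * t))) has_real_derivative c * tan (c * t)) (at t)"
    and "((\<lambda>t. c * tan (c * t)) has_real_derivative c\<^sup>2 / (cos (c * t))\<^sup>2) (at t)"
proof -
  show "((\<lambda>t. - ln (cos (c * t))) has_real_derivative c * tan (c * t)) (at t)"
    using assms by (auto intro!: derivative_eq_intros simp: tan_def)
  have "((\<lambda>t. tan (c * t)) has_real_derivative inverse ((cos (c * t))\<^sup>2) * c) (at t)"
    using assms by (intro DERIV_chain2[OF DERIV_tan] DERIV_cmult_Id) auto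
  from DERIV_cmult[OF this, of c]
  show "((\<lambda>t. c * tan (c * t)) has_real_derivative c\<^sup>2 / (cos (c * t))\<^sup>2) (at t)"
    by (simp add: field_simps power2_eq_square)
qed

text \<open>The summand \<open>ln (sin t / t)\<close> contributes -1/6 and
  \<open>t * cot t - 1\<close> contributes -1/3.\<close>

lemma log_h_asymp: "((\<lambda>t. log_h t / t\<^sup>2) \<longlongrightarrow> - 1 / 2) (at_right 0)"
  unfolding log_h_def cot_def by real_asymp

lemma ln_cos_asymp: "((\<lambda>t. - ln (cos (c * t)) / t\<^sup>2) \<longlongrightarrow> c\<^sup>2 / 2) (at_right 0)" for c :: real
proof (cases "c = 0")
  case False
  then have "((\<lambda>t. - ln (cos (c * t)) / t\<^sup>2) \<longlongrightarrow> c * c / 2) (at_right 0)"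
    by real_asymp
  then show ?thesis
    by (simp add: power2_eq_square)
qed simp

lemma log_h_tendsto_0: "(log_h \<longlongrightarrow> 0) (at_right 0)"
  unfolding log_h_def cot_def by real_asymp

lemma ln_cos_tendsto_0: "((\<lambda>t. - ln (cos (c * t))) \<longlongrightarrow> 0) (at_right 0)" for c :: real
proof -
  have "isCont (\<lambda>t. - ln (cos (c * t))) 0"
    by (intro continuous_intros) auto
  then have "((\<lambda>t. - ln (cos (c * t))) \<longlongrightarrow> 0) (at 0)"
    by (simp add: isCont_def)
  then show ?thesis
    by (rule tendsto_within_subset) simp
qed

lemma cos_less_one:
  assumes "0 < x" "x < pi / 2"
  shows "cos x < 1"
  using assms cos_monotone_0_pi[of 0 x] by simp

lemma ln_cos_neg:
  assumes "0 < x" "x < pi / 2"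
  shows "ln (cos x) < 0"
  using cos_less_one[OF assms] cos_gt_zero[OF assms] by simp

lemma cos_mult_pos:
  assumes "0 < c" "c < 1" "0 < t" "t \<le> pi / 2"
  shows "0 < c * t" "c * t < pi / 2" "0 < cos (c * t)"
proof -
  show pos: "0 < c * t"
    using assms by simp
  have "c * t < 1 * t"
    using assms by (intro mult_strict_right_mono) auto
  then show less: "c * t < pi / 2"
    using assms by linarith
  show "0 < cos (c * t)"
    by (rule cos_gt_zero[OF pos less])
qed

section \<open>Monotone quotients and their limits at 0\<close>

lemma log_h_over_ln_cos_half_mono:
  "strict_mono_on {0<..pi/2} (\<lambda>t. - log_h t / - ln (cos (1/2 * t)))"
proof (rule lhopital_strict_mono)
  fix t assume "t \<in> {0<..pi/2}"
  then have t: "0 < t" "t \<le> pi / 2" "t < pi"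
    by auto
  note c = cos_mult_pos[of "1/2" t, OF _ _ t(1,2), simplified]
  show "((\<lambda>t. - log_h t) has_real_derivative - log_h_deriv t) (at t)"
       "((\<lambda>t. - log_h_deriv t) has_real_derivative - log_h_deriv2 t) (at t)"
    using t by (auto intro!: DERIV_minus DERIV_log_h DERIV_log_h_deriv)
  show "((\<lambda>t. - ln (cos (1/2 * t))) has_real_derivative 1/2 * tan (1/2 * t)) (at t)"
       "((\<lambda>t. 1/2 * tan (1/2 * t)) has_real_derivative (1/2)\<^sup>2 / (cos (1/2 * t))\<^sup>2) (at t)"
    using c by (intro DERIV_ln_cos; simp)+
  show "0 < 1/2 * tan (1/2 * t)"
    using c by (simp add: tan_gt_zero)
  have "- log_h_deriv t < - log_h_deriv2 t * (2 * sin (t / 2) * cos (t / 2))"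
    using log_h_deriv2_bounds(1)[OF t(1,2)] sin_double[of "t/2"] by simp
  then show "- log_h_deriv t * ((1/2)\<^sup>2 / (cos (1/2 * t))\<^sup>2) < - log_h_deriv2 t * (1/2 * tan (1/2 * t))"
    using c by (simp add: tan_def field_simps power2_eq_square)
next
  show "((\<lambda>t. - log_h t) \<longlongrightarrow> 0) (at_right 0)"
    using tendsto_minus[OF log_h_tendsto_0] by simp
qed (rule ln_cos_tendsto_0)

text \<open>Here \<open>log_h\<close> stands in the denominator: the quotient of interest decreases,
  and the l'Hopital rule is stated for increasing ones.\<close>

lemma ln_cos_over_log_h_mono:
  "strict_mono_on {0<..pi/2} (\<lambda>t. - ln (cos (1 / sqrt 3 * t)) / - log_h t)"
proof (rule lhopital_strict_mono)
  fix t assume "t \<in> {0<..pi/2}"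
  then have t: "0 < t" "t \<le> pi / 2" "t < pi"
    by auto
  note c = cos_mult_pos[of "1 / sqrt 3" t, OF _ _ t(1,2), simplified]
  show "((\<lambda>t. - ln (cos (1 / sqrt 3 * t))) has_real_derivative 1 / sqrt 3 * tan (1 / sqrt 3 * t)) (at t)"
       "((\<lambda>t. 1 / sqrt 3 * tan (1 / sqrt 3 * t)) has_real_derivative
          (1 / sqrt 3)\<^sup>2 / (cos (1 / sqrt 3 * t))\<^sup>2) (at t)"
    using c by (intro DERIV_ln_cos; simp)+
  show "((\<lambda>t. - log_h t) has_real_derivative - log_h_deriv t) (at t)"
       "((\<lambda>t. - log_h_deriv t) has_real_derivative - log_h_deriv2 t) (at t)"
    using t by (auto intro!: DERIV_minus DERIV_log_h DERIV_log_h_deriv)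
  show "0 < - log_h_deriv t"
    using log_h_deriv_neg[of t] t by simp
  define u where "u = t / sqrt 3"
  have "cos u > 0"
    using c by (simp add: u_def)
  have "- log_h_deriv2 t * (sqrt 3 * (sin u * cos u)) < - log_h_deriv t"
    using log_h_deriv2_bounds(2)[OF t(1,2)] sin_double[of "u"] by (simp add: u_def mult_ac)
  then have "- log_h_deriv2 t * (sqrt 3 * (sin u * cos u)) / (3 * (cos u)\<^sup>2) < - log_h_deriv t / (3 * (cos u)\<^sup>2)"
    using \<open>cos u > 0\<close> by (intro divide_strict_right_mono) auto
  moreover have "sqrt 3 * (sin u * cos u) / (3 * (cos u)\<^sup>2) = tan u / sqrt 3"
    using \<open>cos u > 0\<close> by (simp add: tan_def field_simps power2_eq_square)
  ultimately have "- log_h_deriv2 t * (tan u / sqrt 3) < - log_h_deriv t / (3 * (cos u)\<^sup>2)"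
    by (metis times_divide_eq_right)
  then show "1 / sqrt 3 * tan (1 / sqrt 3 * t) * - log_h_deriv2 t < (1 / sqrt 3)\<^sup>2 / (cos (1 / sqrt 3 * t))\<^sup>2 * - log_h_deriv t"
    by (simp add: u_def power_divide mult_ac)
next
  show "((\<lambda>t. - log_h t) \<longlongrightarrow> 0) (at_right 0)"
    using tendsto_minus[OF log_h_tendsto_0] by simp
qed (rule ln_cos_tendsto_0)

text \<open>Taking \<open>t^2\<close> as the denominator reduces the l'Hopital condition to
  \<open>sin t * cos t < t\<close>. The interval ends at \<open>y < pi / 2\<close> so that cos stays
  positive.\<close>

lemma ln_cos_over_square_mono:
  assumes "0 < x" "x \<le> y" "y < pi / 2"
  shows "- ln (cos x) / x\<^sup>2 \<le> - ln (cos y) / y\<^sup>2"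
proof -
  have "strict_mono_on {0<..y} (\<lambda>x. - ln (cos (1 * x)) / x\<^sup>2)"
  proof (rule lhopital_strict_mono)
    fix t assume "t \<in> {0<..y}"
    then have t: "0 < t" "t < pi / 2"
      using assms by auto
    then have c: "cos t > 0" "sin t > 0"
      by (auto intro!: cos_gt_zero sin_gt_zero)
    show "((\<lambda>t. - ln (cos (1 * t))) has_real_derivative 1 * tan (1 * t)) (at t)"
         "((\<lambda>t. 1 * tan (1 * t)) has_real_derivative 1\<^sup>2 / (cos (1 * t))\<^sup>2) (at t)"
      using c by (intro DERIV_ln_cos; simp)+
    show "((\<lambda>t. t\<^sup>2) has_real_derivative 2 * t) (at t)"
         "((\<lambda>t. 2 * t) has_real_derivative 2) (at t)"
      by (auto intro!: derivative_eq_intros)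
    show "0 < 2 * t"
      using t by simp
    have "sin t * cos t < sin t * 1"
      using c cos_less_one[OF t] by (intro mult_strict_left_mono) auto
    also have "\<dots> \<le> t"
      using sin_le_poly[of 1 t] t by (simp add: sin_poly_def)
    finally show "1 * tan (1 * t) * 2 < 1\<^sup>2 / (cos (1 * t))\<^sup>2 * (2 * t)"
      using c by (simp add: tan_def field_simps power2_eq_square)
  next
    show "((\<lambda>t::real. t\<^sup>2) \<longlongrightarrow> 0) (at_right 0)"
      by real_asymp
  qed (rule ln_cos_tendsto_0)
  then show ?thesis
    using strict_mono_onD[of "{0<..y}" "\<lambda>x. - ln (cos (1 * x)) / x\<^sup>2" x y] assms
    by (cases "x = y") auto
qed

text \<open>Numerator and denominator are both divided by \<open>t^2\<close>. The limit is 4 for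
  \<open>c = 1/2\<close> and 3 for \<open>c = 1 / sqrt 3\<close>.\<close>

lemma log_h_over_ln_cos_tendsto:
  fixes c :: real
  assumes "c \<noteq> 0"
  shows "((\<lambda>t. - log_h t / - ln (cos (c * t))) \<longlongrightarrow> 1 / c\<^sup>2) (at_right 0)"
proof (rule Lim_transform_eventually)
  show "((\<lambda>t. - (log_h t / t\<^sup>2) / (- ln (cos (c * t)) / t\<^sup>2)) \<longlongrightarrow> 1 / c\<^sup>2) (at_right 0)"
    by (rule tendsto_eq_rhs[OF tendsto_divide[OF tendsto_minus[OF log_h_asymp] ln_cos_asymp]])
       (use assms in auto)
  show "\<forall>\<^sub>F t in at_right 0. - (log_h t / t\<^sup>2) / (- ln (cos (c * t)) / t\<^sup>2) = - log_h t / - ln (cos (c * t))"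
    by (rule eventually_at_rightI[of 0 1]) auto
qed

lemma log_h_over_ln_cos_half_greater:
  assumes "0 < t" "t \<le> pi / 2"
  shows "4 < - log_h t / - ln (cos (1/2 * t))"
  using log_h_over_ln_cos_tendsto[of "1/2"] assms
  by (intro strict_mono_on_less_limit[OF log_h_over_ln_cos_half_mono]) (auto simp: power2_eq_square)

lemma log_h_neg:
  assumes "0 < t" "t \<le> pi / 2"
  shows "log_h t < 0"
proof -
  have "0 < - log_h t"
  proof (rule pos_of_deriv_pos[where f = "\<lambda>t. - log_h t" and f' = "\<lambda>t. - log_h_deriv t"])
    show "((\<lambda>t. - log_h t) has_real_derivative - log_h_deriv x) (at x)" if "x \<in> {0<..pi/2}" for x
      using that by (auto intro!: DERIV_minus DERIV_log_h)
    show "0 < - log_h_deriv x" if "x \<in> {0<..<pi/2}" for x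
      using that log_h_deriv_neg[of x] by auto
    show "((\<lambda>t. - log_h t) \<longlongrightarrow> 0) (at_right 0)"
      using tendsto_minus[OF log_h_tendsto_0] by simp
  qed (use assms in auto)
  then show ?thesis by simp
qed

lemma log_h_ln_cos_sqrt3_less:
  assumes "0 < t" "t \<le> pi / 2"
  shows "- log_h t < 3 * - ln (cos (1 / sqrt 3 * t))"
proof -
  have "((\<lambda>t. inverse (- log_h t / - ln (cos (1 / sqrt 3 * t)))) \<longlongrightarrow> inverse (1 / (1 / sqrt 3)\<^sup>2)) (at_right 0)"
    by (intro tendsto_inverse log_h_over_ln_cos_tendsto) auto
  then have "((\<lambda>t. - ln (cos (1 / sqrt 3 * t)) / - log_h t) \<longlongrightarrow> 1 / 3) (at_right 0)"
    by (simp add: power_divide)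
  then have "1 / 3 < - ln (cos (1 / sqrt 3 * t)) / - log_h t"
    using assms by (intro strict_mono_on_less_limit[OF ln_cos_over_log_h_mono]) auto
  then show ?thesis
    using log_h_neg[OF assms] by (simp add: field_simps)
qed

section \<open>From logarithms to the bounds with general p and q\<close>

lemma powr_less_h_fun_iff:
  assumes "0 < t" "t < pi" "0 < c"
  shows "c powr r < h_fun t \<longleftrightarrow> - log_h t < 2 * r * - ln c"
    and "h_fun t < c powr r \<longleftrightarrow> 2 * r * - ln c < - log_h t"
  using assms by (auto simp: h_fun_eq_exp powr_def)

text \<open>After taking logarithms, the case \<open>1 / sqrt 3\<close> bounds
  \<open>- log_h t\<close>. Monotonicity of \<open>- ln (cos x) / x^2\<close> between
  \<open>t / sqrt 3\<close> and \<open>p * t\<close> then passes to general \<open>p\<close>;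
  \<open>p \<le> 1\<close> keeps \<open>p * t\<close> below \<open>pi / 2\<close>.\<close>

lemma cos_powr_less_h_fun:
  assumes "1 / sqrt 3 \<le> p" "p \<le> 1" "0 < t" "t < pi / 2"
  shows "cos (p * t) powr (1 / (2 * p\<^sup>2)) < h_fun t"
proof -
  have "0 < p"
    using assms(1) by (rule order_less_le_trans[rotated]) simp
  have "p * t \<le> 1 * t"
    using assms by (intro mult_right_mono) auto
  moreover have "0 < p * t"
    using \<open>0 < p\<close> assms by simp
  ultimately have pt: "0 < p * t" "p * t < pi / 2"
    using assms by linarith+
  have "p\<^sup>2 * - log_h t < p\<^sup>2 * (3 * - ln (cos (1 / sqrt 3 * t)))"
    using log_h_ln_cos_sqrt3_less[of t] assms \<open>0 < p\<close> by (intro mult_strict_left_mono) auto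
  moreover have "- ln (cos (1 / sqrt 3 * t)) / (1 / sqrt 3 * t)\<^sup>2 \<le> - ln (cos (p * t)) / (p * t)\<^sup>2"
    by (rule ln_cos_over_square_mono[OF _ mult_right_mono[OF assms(1)] pt(2)]) (use assms in auto)
  then have "p\<^sup>2 * (3 * - ln (cos (1 / sqrt 3 * t))) \<le> - ln (cos (p * t))"
    using \<open>0 < p\<close> assms by (simp add: power_mult_distrib power_divide field_simps)
  ultimately have "p\<^sup>2 * - log_h t < - ln (cos (p * t))"
    by linarith
  then show ?thesis
    using assms pt \<open>0 < p\<close> by (subst powr_less_h_fun_iff) (auto intro!: cos_gt_zero simp: field_simps)
qed

lemma h_fun_less_cos_powr:
  assumes "0 < q" "q \<le> 1 / 2" "0 < t" "t < pi / 2"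
  shows "h_fun t < cos (q * t) powr (1 / (2 * q\<^sup>2))"
proof -
  have pos: "- ln (cos (1/2 * t)) > 0"
    using assms by (simp add: ln_cos_neg)
  have qt: "q * t \<le> 1 / 2 * t" "1 / 2 * t < pi / 2" "0 < q * t"
    using assms by (auto intro!: mult_right_mono)
  have "4 * - ln (cos (1/2 * t)) < - log_h t"
    using log_h_over_ln_cos_half_greater[of t] assms unfolding pos_less_divide_eq[OF pos] by simp
  then have "q\<^sup>2 * (4 * - ln (cos (1/2 * t))) < q\<^sup>2 * - log_h t"
    using assms by (intro mult_strict_left_mono) auto
  moreover have "- ln (cos (q * t)) / (q * t)\<^sup>2 \<le> - ln (cos (1/2 * t)) / (1/2 * t)\<^sup>2"
    by (rule ln_cos_over_square_mono[OF qt(3,1,2)])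
  then have "- ln (cos (q * t)) \<le> q\<^sup>2 * (4 * - ln (cos (1/2 * t)))"
    using assms by (simp add: power_mult_distrib power_divide field_simps)
  ultimately have "- ln (cos (q * t)) < q\<^sup>2 * - log_h t"
    by linarith
  moreover have "0 < cos (q * t)"
    using qt by (intro cos_gt_zero) linarith+
  ultimately show ?thesis
    using assms by (subst powr_less_h_fun_iff) (auto simp: field_simps)
qed

section \<open>End values at pi/2 and best exponents\<close>

lemma log_h_pi_half: "log_h (pi / 2) = - (ln pi - ln 2 + 1)"
  by (simp add: log_h_def ln_div cot_def)

lemma beta_exp_eq: "- log_h (pi / 2) / - ln (cos (1/2 * (pi / 2))) = 2 * beta_exp"
proof -
  have "ln (cos (pi / 4)) = - ln 2 / 2"
    by (simp add: cos_45 ln_div ln_sqrt)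
  then show ?thesis
    by (simp add: log_h_pi_half beta_exp_def)
qed

lemma gamma_exp_eq: "- log_h (pi / 2) / - ln (cos (1 / sqrt 3 * (pi / 2))) = 2 * gamma_exp"
proof -
  have "1 / sqrt 3 * (pi / 2) = pi / (2 * sqrt 3)"
    by simp
  then show ?thesis
    unfolding log_h_pi_half gamma_exp_def by (simp only:)
qed

lemma log_h_over_ln_cos_tendsto_pi_half:
  assumes "0 < c" "c < 1"
  shows "((\<lambda>t. - log_h t / - ln (cos (c * t))) \<longlongrightarrow>
    - log_h (pi / 2) / - ln (cos (c * (pi / 2)))) (at_left (pi / 2))"
proof -
  \<comment> \<open>Because \<open>c < 1\<close>, the point \<open>c * (pi / 2)\<close> lies
    strictly inside the first quadrant, so the denominator does not vanish and the quotient is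
    continuous at \<open>pi / 2\<close>.\<close>
  have c: "cos (c * (pi / 2)) > 0" "ln (cos (c * (pi / 2))) < 0"
    using cos_mult_pos[OF assms, of "pi / 2"] ln_cos_neg[of "c * (pi / 2)"] by auto
  have "isCont log_h (pi / 2)"
    by (rule DERIV_isCont[OF DERIV_log_h]) auto
  then have "isCont (\<lambda>t. - log_h t / - ln (cos (c * t))) (pi / 2)"
    using c by (intro continuous_intros) auto
  then show ?thesis
    unfolding isCont_def by (rule tendsto_within_subset) simp
qed

lemma log_h_over_ln_cos_half_less:
  assumes "0 < t" "t < pi / 2"
  shows "- log_h t / - ln (cos (1/2 * t)) < 2 * beta_exp"
  using strict_mono_onD[OF log_h_over_ln_cos_half_mono, of t "pi/2"] assms
  unfolding beta_exp_eq by simp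

lemma log_h_over_ln_cos_sqrt3_greater:
  assumes "0 < t" "t < pi / 2"
  shows "2 * gamma_exp < - log_h t / - ln (cos (1 / sqrt 3 * t))"
proof -
  have "- ln (cos (1 / sqrt 3 * t)) / - log_h t
      < - ln (cos (1 / sqrt 3 * (pi / 2))) / - log_h (pi / 2)"
    using strict_mono_onD[OF ln_cos_over_log_h_mono, of t "pi/2"] assms by simp
  \<comment> \<open>Positivity lets the passage to reciprocals reverse the inequality.\<close>
  moreover have "0 < - ln (cos (1 / sqrt 3 * t)) / - log_h t"
    using log_h_neg[of t] ln_cos_neg[of "1 / sqrt 3 * t"] cos_mult_pos[of "1 / sqrt 3" t] assms
    by (intro divide_pos_pos) auto
  ultimately show ?thesis
    unfolding gamma_exp_eq[symmetric] using less_imp_inverse_less by fastforce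
qed

text \<open>Each bound for \<open>h_fun\<close> says that the quotient of logarithms stays on one
  side of \<open>2 * r\<close>; letting \<open>t\<close> tend to 0 or to \<open>pi / 2\<close> keeps
  the weak inequality. The limit at 0 yields the exponents 2 and 3/2, the limit at
  \<open>pi / 2\<close> yields \<open>beta_exp\<close> and \<open>gamma_exp\<close>.\<close>

lemma best_exponents:
  fixes c l r :: real
  assumes c: "0 < c" "c < 1"
  shows "\<forall>t\<in>{0<..<pi/2}. cos (c * t) powr r < h_fun t \<Longrightarrow> 1 / c\<^sup>2 \<le> 2 * r"
    and "\<forall>t\<in>{0<..<pi/2}. cos (c * t) powr r < h_fun t \<Longrightarrow> - log_h (pi / 2) / - ln (cos (c * (pi / 2))) \<le> 2 * r"
    and "\<forall>t\<in>{0<..<pi/2}. h_fun t < cos (c * t) powr r \<Longrightarrow> 2 * r \<le> 1 / c\<^sup>2"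
    and "\<forall>t\<in>{0<..<pi/2}. h_fun t < cos (c * t) powr r \<Longrightarrow> 2 * r \<le> - log_h (pi / 2) / - ln (cos (c * (pi / 2)))"
proof -
  have iff: "cos (c * t) powr r < h_fun t \<longleftrightarrow> - log_h t / - ln (cos (c * t)) < 2 * r"
    "h_fun t < cos (c * t) powr r \<longleftrightarrow> 2 * r < - log_h t / - ln (cos (c * t))"
    if "t \<in> {0<..<pi/2}" for t
  proof -
    have t: "0 < t" "t < pi" "0 < cos (c * t)" "0 < - ln (cos (c * t))"
      using that cos_mult_pos[OF c, of t] ln_cos_neg[of "c * t"] by auto
    show "cos (c * t) powr r < h_fun t \<longleftrightarrow> - log_h t / - ln (cos (c * t)) < 2 * r"
      "h_fun t < cos (c * t) powr r \<longleftrightarrow> 2 * r < - log_h t / - ln (cos (c * t))"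
      unfolding powr_less_h_fun_iff[OF t(1-3)] pos_divide_less_eq[OF t(4)] pos_less_divide_eq[OF t(4)] by auto
  qed
  note ev = eventually_at_rightI[of 0 "pi/2" _, OF _ pi_half_gt_zero]
    eventually_at_leftI[of 0 "pi/2" _, OF _ pi_half_gt_zero]
  note lims = log_h_over_ln_cos_tendsto[of c] log_h_over_ln_cos_tendsto_pi_half[OF c]
  { assume *: "\<forall>t\<in>{0<..<pi/2}. cos (c * t) powr r < h_fun t"
    show "1 / c\<^sup>2 \<le> 2 * r"
      by (rule tendsto_upperbound[OF lims(1)]) (use c * iff(1) in \<open>auto intro!: ev less_imp_le\<close>)
    show "- log_h (pi / 2) / - ln (cos (c * (pi / 2))) \<le> 2 * r"
      by (rule tendsto_upperbound[OF lims(2)]) (use * iff(1) in \<open>auto intro!: ev less_imp_le\<close>) }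
  { assume *: "\<forall>t\<in>{0<..<pi/2}. h_fun t < cos (c * t) powr r"
    show "2 * r \<le> 1 / c\<^sup>2"
      by (rule tendsto_lowerbound[OF lims(1)]) (use c * iff(2) in \<open>auto intro!: ev less_imp_le\<close>)
    show "2 * r \<le> - log_h (pi / 2) / - ln (cos (c * (pi / 2)))"
      by (rule tendsto_lowerbound[OF lims(2)]) (use * iff(2) in \<open>auto intro!: ev less_imp_le\<close>) }
qed

section \<open>The constant sqrt (8 / (pi e))\<close>

lemma beta_exp_gt_2: "2 < beta_exp"
proof -
  \<comment> \<open>The claim amounts to \<open>exp 1 * pi > 8\<close>. As \<open>pi\<close> is only
    bounded by 3, a sharp enough bound for e is needed: \<open>25/18 = 1 + 1/3 + 1/18\<close> is the
    quadratic Taylor value at 1/3, and \<open>3 * (25/18)^3\<close> just exceeds 8.\<close>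
  have "(25 / 18) ^ 3 \<le> exp (1/3::real) ^ 3"
    using exp_lower_Taylor_quadratic[of "1/3::real"] by (intro power_mono) (auto simp: power2_eq_square)
  then have "exp (1::real) \<ge> (25 / 18) ^ 3"
    by (simp flip: exp_of_nat_mult)
  then have "(25/18)^3 * 3 < exp 1 * pi"
    using pi_gt_three by (intro mult_le_less_imp_less) auto
  moreover have "2 ^ 3 < (25 / 18) ^ 3 * (3::real)"
    by (simp add: power_divide)
  ultimately have "2 ^ 3 < exp 1 * pi"
    by linarith
  then have "ln (2 ^ 3) < ln (exp 1 * pi)"
    by (intro ln_less_cancel_iff[THEN iffD2]) auto
  moreover have "ln (2 ^ 3 :: real) = 3 * ln 2"
    using ln_realpow[of 2 3] by simp
  ultimately have "3 * ln 2 < 1 + ln pi"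
    by (simp add: ln_mult)
  then show ?thesis
    by (simp add: beta_exp_def pos_less_divide_eq)
qed

text \<open>The constant equals \<open>cos (pi / 4) powr (beta_exp - 2)\<close>, so the two sides
  would agree at \<open>t = pi / 2\<close>. For smaller \<open>t\<close> the base
  \<open>cos (t / 2)\<close> is larger and the exponent \<open>beta_exp - 2\<close> is
  positive.\<close>

lemma sqrt_const_less:
  assumes "0 < t" "t < pi / 2"
  shows "sqrt (8 / (pi * exp 1)) * (cos (t / 2))\<^sup>2 < cos (t / 2) powr beta_exp"
proof -
  have c: "cos (pi / 4) < cos (t / 2)" "0 < cos (t / 2)"
    using assms by (auto intro!: cos_monotone_0_pi cos_gt_zero)
  have "ln (sqrt (8 / (pi * exp 1))) = (3 * ln 2 - ln pi - 1) / 2"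
    using ln_realpow[of 2 3] by (simp add: ln_sqrt ln_div ln_mult)
  also have "\<dots> = (beta_exp - 2) * ln (cos (pi / 4))"
    by (simp add: cos_45 ln_div ln_sqrt beta_exp_def field_simps)
  also have "\<dots> < (beta_exp - 2) * ln (cos (t / 2))"
    using c beta_exp_gt_2 by (intro mult_strict_left_mono) (auto simp: cos_45)
  also have "\<dots> = ln (cos (t / 2) powr (beta_exp - 2))"
    using c by (simp add: ln_powr)
  finally have "sqrt (8 / (pi * exp 1)) < cos (t / 2) powr (beta_exp - 2)"
    using c by (subst (asm) ln_less_cancel_iff) auto
  then have "sqrt (8 / (pi * exp 1)) * (cos (t / 2))\<^sup>2 < cos (t / 2) powr (beta_exp - 2) * (cos (t / 2))\<^sup>2"
    using c by (intro mult_strict_right_mono) auto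
  also have "\<dots> = cos (t / 2) powr beta_exp"
    using c by (simp add: powr_diff)
  finally show ?thesis .
qed

theorem theorem4:
  shows "(\<forall>p\<in>{1 / sqrt 3..1::real}. \<forall>q\<in>{0<..1/2::real}. \<forall>t\<in>{0<..<pi/2}.
            cos (p * t) powr (1 / (2 * p\<^sup>2)) < h_fun t \<and>
            h_fun t < cos (q * t) powr (1 / (2 * q\<^sup>2)))
       \<and> (\<forall>t\<in>{0<..<pi/2}.
            sqrt (8 / (pi * exp 1)) * (cos (t / 2))\<^sup>2 < cos (t / 2) powr beta_exp \<and>
            cos (t / 2) powr beta_exp < h_fun t \<and>
            h_fun t < (cos (t / 2))\<^sup>2)
       \<and> (\<forall>t\<in>{0<..<pi/2}.
            cos (t / sqrt 3) powr (3 / 2) < h_fun t \<and>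
            h_fun t < cos (t / sqrt 3) powr gamma_exp)
       \<and> (\<forall>t\<in>{0<..<pi/2}.
            sqrt (cos t) < h_fun t \<and>
            h_fun t < (cos (t / 2))\<^sup>2)
       \<and> (\<forall>r::real. (\<forall>t\<in>{0<..<pi/2}. cos (t / 2) powr r < h_fun t) \<longrightarrow> r \<ge> beta_exp)
       \<and> (\<forall>s::real. (\<forall>t\<in>{0<..<pi/2}. h_fun t < cos (t / 2) powr s) \<longrightarrow> s \<le> 2)
       \<and> (\<forall>r::real. (\<forall>t\<in>{0<..<pi/2}. cos (t / sqrt 3) powr r < h_fun t) \<longrightarrow> r \<ge> 3 / 2)
       \<and> (\<forall>s::real. (\<forall>t\<in>{0<..<pi/2}. h_fun t < cos (t / sqrt 3) powr s) \<longrightarrow> s \<le> gamma_exp)"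
proof (intro conjI ballI allI impI)
  fix t :: real assume "t \<in> {0<..<pi/2}"
  then have t: "0 < t" "t < pi / 2" "t < pi"
    by auto
  show "cos (p * t) powr (1 / (2 * p\<^sup>2)) < h_fun t" if "p \<in> {1 / sqrt 3..1}" for p
    using cos_powr_less_h_fun[of p t] that t by auto
  show "h_fun t < cos (q * t) powr (1 / (2 * q\<^sup>2))" if "q \<in> {0<..1/2}" for q
    using h_fun_less_cos_powr[of q t] that t by auto
  show "sqrt (8 / (pi * exp 1)) * (cos (t / 2))\<^sup>2 < cos (t / 2) powr beta_exp"
    using sqrt_const_less t by blast
  have c: "0 < cos (t / 2)" "0 < cos (t / sqrt 3)" "ln (cos (t / 2)) < 0" "ln (cos (t / sqrt 3)) < 0"
    using cos_mult_pos[of "1/2" t] cos_mult_pos[of "1 / sqrt 3" t] t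
      ln_cos_neg[of "t / 2"] ln_cos_neg[of "t / sqrt 3"] by simp_all
  show "cos (t / 2) powr beta_exp < h_fun t"
    using log_h_over_ln_cos_half_less[OF t(1,2)] t c
    by (subst powr_less_h_fun_iff) (auto simp: field_simps)
  \<comment> \<open>The same bound occurs in two conjuncts; it is the case \<open>q = 1/2\<close>,
    with exponent 2.\<close>
  show "h_fun t < (cos (t / 2))\<^sup>2" "h_fun t < (cos (t / 2))\<^sup>2"
    using h_fun_less_cos_powr[of "1/2" t] t c by (auto simp: power2_eq_square powr_numeral)
  show "cos (t / sqrt 3) powr (3 / 2) < h_fun t"
    using cos_powr_less_h_fun[of "1 / sqrt 3" t] t by (simp add: power_divide)
  show "h_fun t < cos (t / sqrt 3) powr gamma_exp"
    using log_h_over_ln_cos_sqrt3_greater[OF t(1,2)] t c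
    by (subst powr_less_h_fun_iff) (auto simp: field_simps)
  \<comment> \<open>The case \<open>p = 1\<close>, where the exponent is 1/2.\<close>
  show "sqrt (cos t) < h_fun t"
    using cos_powr_less_h_fun[of 1 t] t by (simp add: powr_half_sqrt cos_ge_zero)
next
  fix r :: real assume "\<forall>t\<in>{0<..<pi/2}. cos (t / 2) powr r < h_fun t"
  then show "beta_exp \<le> r"
    using best_exponents(2)[of "1/2" r] beta_exp_eq by simp
next
  fix s :: real assume "\<forall>t\<in>{0<..<pi/2}. h_fun t < cos (t / 2) powr s"
  then show "s \<le> 2"
    using best_exponents(3)[of "1/2" s] by (simp add: power2_eq_square)
next
  fix r :: real assume "\<forall>t\<in>{0<..<pi/2}. cos (t / sqrt 3) powr r < h_fun t"
  then show "3 / 2 \<le> r"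
    using best_exponents(1)[of "1 / sqrt 3" r] by (simp add: power_divide)
next
  fix s :: real assume "\<forall>t\<in>{0<..<pi/2}. h_fun t < cos (t / sqrt 3) powr s"
  then show "s \<le> gamma_exp"
    using best_exponents(4)[of "1 / sqrt 3" s] gamma_exp_eq by simp
qed

end
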